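(* Let $\Gamma$ be a countable discrete group and $x\in H^2(\Gamma;\mathbb{Z})$ a class, corresponding to the central extension $$1\to\mathbb{Z}\xrightarrow{\ \iota\ }\tilde\Gamma\xrightarrow{\ \varphi\ }\Gamma\to1,$$ such that $x$ is not in the kernel of the map $H^2(\Gamma;\mathbb{Z})\to\mathrm{Hom}(H_2(\Gamma;\mathbb{Z}),\mathbb{Z})$ induced by the Kronecker pairing and there is a sequence of finite index subgroups $\Gamma_k\le\tilde\Gamma$ with $\iota(\mathbb{Z})\cap\bigcap_k\Gamma_k=\{e\}$. Let $S$ be the set of $n\in\mathbb{N}$ for which $\tilde\Gamma$ has a finite quotient $\tilde Q_n$ in which the image of $\iota(1)$ has order $n$. Let $\theta:\Gamma\to\tilde\Gamma$ be a set-theoretic section of $\varphi$, with associated cocycle $\sigma$ representing $x$. For $n\in S$ let $\tilde q_n:\tilde\Gamma\to\tilde Q_n$ be the quotient map, $Q_n=\tilde Q_n/\langle\tilde q_n(\iota(1))\rangle$ the corresponding finite quotient of $\Gamma$, and $\pi_n$ the representation of $\tilde Q_n$ induced from the character of $\langle\tilde q_n(\iota(1))\rangle$ given by $\tilde q_n(\iota(1))\mapsto\exp(2\pi i/n)$. Then for every $n\in S$ the map $\pi_n\circ\tilde q_n\circ\theta$ is equivalent to a map $\rho_n$ of the following form: there are a cocycle $\sigma_n$ representing $x$ of $n$-$Q_n$ type and a cochain $\alpha_n\in C^1(\Gamma;\mathbb{Z})$ with $\sigma_n+\partial\alpha_n=\sigma$ such that, if $\rho_n:\Gamma\to U(\ell^2(Q_n))$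 is defined by $$\rho_n(g_1)\bar g_2=\exp\!\left(\tfrac{2\pi i}{n}\big(\alpha_n(g_1)+\sigma_n(g_1,g_2)\big)\right)\bar g_1\bar g_2\qquad(g_1,g_2\in\Gamma),$$ then there is a unitary isomorphism $W$ from $\ell^2(Q_n)$ onto the space of $\pi_n$ with $W\rho_n(g)W^{-1}=\pi_n(\tilde q_n(\theta(g)))$ for all $g\in\Gamma$.
   Context: Here $\bar g\in Q_n$ denotes the image of $g\in\Gamma$, regarded as a standard orthonormal basis vector of $\ell^2(Q_n)$. Cochains are inhomogeneous with trivial action: $C^k(\Gamma;A)$ is the group of functions $\Gamma^k\to A$ and $\partial\alpha(g,h)=\alpha(h)-\alpha(gh)+\alpha(g)$ for $\alpha\in C^1(\Gamma;A)$. The cocycle associated with a section $\theta$ is determined by $\iota(\sigma(g,h))=\theta(g)\theta(h)\theta(gh)^{-1}$; its class is the class in $H^2(\Gamma;\mathbb{Z})$ corresponding to the central extension. Let $Q$ be a finite quotient of $\Gamma$ with quotient map $q$. A cocycle $\tau\in C^2(\Gamma;\mathbb{Z})$ is of $n$-$Q$ type if there is a cocycle $\tau'\in C^2(Q;\mathbb{Z}/n\mathbb{Z})$ with $\tau(g,h)\bmod n=\tau'(q(g),q(h))$ for all $g,h\in\Gamma$. (This makes the formula for $\rho_n$ well defined.) *)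

theory Defs
  imports Complex_Main "HOL-Algebra.Algebra"
begin

section \<open>Low-degree group cohomology with trivial coefficients\<close>

text \<open>The coefficient group A is written multiplicatively, as everywhere in HOL-Algebra; for
  \<^const>\<open>integer_group\<close> and \<^const>\<open>integer_mod_group\<close> its operation is addition. Cochains are
  extensional functions, so that equality of cochains means equality on the powers of the group.\<close>

definition C1 :: "('g, 'm) monoid_scheme \<Rightarrow> ('a, 'k) monoid_scheme \<Rightarrow> ('g \<Rightarrow> 'a) monoid" where
  "C1 G A = product_group (carrier G) (\<lambda>_. A)"

definition C2 :: "('g, 'm) monoid_scheme \<Rightarrow> ('a, 'k) monoid_scheme \<Rightarrow> ('g \<times> 'g \<Rightarrow> 'a) monoid" where
  "C2 G A = product_group (carrier G \<times> carrier G) (\<lambda>_. A)"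

definition C3 :: "('g, 'm) monoid_scheme \<Rightarrow> ('a, 'k) monoid_scheme \<Rightarrow> ('g \<times> 'g \<times> 'g \<Rightarrow> 'a) monoid" where
  "C3 G A = product_group (carrier G \<times> carrier G \<times> carrier G) (\<lambda>_. A)"

definition cobd1 ::
  "('g, 'm) monoid_scheme \<Rightarrow> ('a, 'k) monoid_scheme \<Rightarrow> ('g \<Rightarrow> 'a) \<Rightarrow> ('g \<times> 'g \<Rightarrow> 'a)" where
  "cobd1 G A \<alpha> = (\<lambda>(g, h) \<in> carrier G \<times> carrier G.
     \<alpha> h \<otimes>\<^bsub>A\<^esub> inv\<^bsub>A\<^esub> (\<alpha> (g \<otimes>\<^bsub>G\<^esub> h)) \<otimes>\<^bsub>A\<^esub> \<alpha> g)"

definition cobd2 ::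
  "('g, 'm) monoid_scheme \<Rightarrow> ('a, 'k) monoid_scheme \<Rightarrow> ('g \<times> 'g \<Rightarrow> 'a) \<Rightarrow> ('g \<times> 'g \<times> 'g \<Rightarrow> 'a)" where
  "cobd2 G A \<tau> = (\<lambda>(g, h, k) \<in> carrier G \<times> carrier G \<times> carrier G.
     \<tau> (h, k) \<otimes>\<^bsub>A\<^esub> inv\<^bsub>A\<^esub> (\<tau> (g \<otimes>\<^bsub>G\<^esub> h, k)) \<otimes>\<^bsub>A\<^esub> \<tau> (g, h \<otimes>\<^bsub>G\<^esub> k) \<otimes>\<^bsub>A\<^esub> inv\<^bsub>A\<^esub> (\<tau> (g, h)))"

definition cocycles2 :: "('g, 'm) monoid_scheme \<Rightarrow> ('a, 'k) monoid_scheme \<Rightarrow> ('g \<times> 'g \<Rightarrow> 'a) set" where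
  "cocycles2 G A = kernel (C2 G A) (C3 G A) (cobd2 G A)"

definition coboundaries2 :: "('g, 'm) monoid_scheme \<Rightarrow> ('a, 'k) monoid_scheme \<Rightarrow> ('g \<times> 'g \<Rightarrow> 'a) set" where
  "coboundaries2 G A = cobd1 G A ` carrier (C1 G A)"

text \<open>A class is a coset of the coboundaries, so ``\<open>\<sigma>\<close> represents \<open>x\<close>'' reads \<open>\<sigma> \<in> x\<close>.\<close>

definition cohomology2 :: "('g, 'm) monoid_scheme \<Rightarrow> ('a, 'k) monoid_scheme \<Rightarrow> ('g \<times> 'g \<Rightarrow> 'a) set monoid" where
  "cohomology2 G A = (C2 G A)\<lparr>carrier := cocycles2 G A\<rparr> Mod coboundaries2 G A"


section \<open>Second integral homology and the Kronecker pairing\<close>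

definition bd2 :: "('g, 'm) monoid_scheme \<Rightarrow> ('g \<times> 'g \<Rightarrow>\<^sub>0 int) \<Rightarrow> ('g \<Rightarrow>\<^sub>0 int)" where
  "bd2 G = frag_extend (\<lambda>(g, h). frag_of h - frag_of (g \<otimes>\<^bsub>G\<^esub> h) + frag_of g)"

definition bd3 :: "('g, 'm) monoid_scheme \<Rightarrow> ('g \<times> 'g \<times> 'g \<Rightarrow>\<^sub>0 int) \<Rightarrow> ('g \<times> 'g \<Rightarrow>\<^sub>0 int)" where
  "bd3 G = frag_extend (\<lambda>(g, h, k).
     frag_of (h, k) - frag_of (g \<otimes>\<^bsub>G\<^esub> h, k) + frag_of (g, h \<otimes>\<^bsub>G\<^esub> k) - frag_of (g, h))"

definition cycles2 :: "('g, 'm) monoid_scheme \<Rightarrow> ('g \<times> 'g \<Rightarrow>\<^sub>0 int) set" where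
  "cycles2 G = kernel (free_Abelian_group (carrier G \<times> carrier G)) (free_Abelian_group (carrier G)) (bd2 G)"

definition boundaries2 :: "('g, 'm) monoid_scheme \<Rightarrow> ('g \<times> 'g \<Rightarrow>\<^sub>0 int) set" where
  "boundaries2 G = bd3 G ` carrier (free_Abelian_group (carrier G \<times> carrier G \<times> carrier G))"

definition homology2 :: "('g, 'm) monoid_scheme \<Rightarrow> ('g \<times> 'g \<Rightarrow>\<^sub>0 int) set monoid" where
  "homology2 G = (free_Abelian_group (carrier G \<times> carrier G))\<lparr>carrier := cycles2 G\<rparr> Mod boundaries2 G"

definition hom_group :: "('a, 'm) monoid_scheme \<Rightarrow> ('b, 'k) monoid_scheme \<Rightarrow> ('a \<Rightarrow> 'b) monoid" where
  "hom_group A B = (product_group (carrier A) (\<lambda>_. B))\<lparr>carrier := hom A B \<inter> extensional (carrier A)\<rparr>"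

definition eval_chain :: "('c \<Rightarrow> int) \<Rightarrow> ('c \<Rightarrow>\<^sub>0 int) \<Rightarrow> int" where
  "eval_chain \<tau> c = (\<Sum>p\<in>Poly_Mapping.keys c. Poly_Mapping.lookup c p * \<tau> p)"

text \<open>The value on a pair of classes is the common value on all pairs of representatives.\<close>

definition kronecker ::
  "('g, 'm) monoid_scheme \<Rightarrow> ('g \<times> 'g \<Rightarrow> int) set \<Rightarrow> ('g \<times> 'g \<Rightarrow>\<^sub>0 int) set \<Rightarrow> int" where
  "kronecker G x = (\<lambda>y \<in> carrier (homology2 G). the_elem {eval_chain \<tau> c |\<tau> c. \<tau> \<in> x \<and> c \<in> y})"


section \<open>Central extensions by the integers\<close>

definition central_extension ::
  "('g, 'm) monoid_scheme \<Rightarrow> ('e, 'k) monoid_scheme \<Rightarrow> (int \<Rightarrow> 'e) \<Rightarrow> ('e \<Rightarrow> 'g) \<Rightarrow> bool" where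
  "central_extension G E \<iota> \<phi> \<longleftrightarrow>
     group G \<and> group E \<and> \<iota> \<in> mon integer_group E \<and> \<phi> \<in> epi E G \<and> kernel E G \<phi> = range \<iota> \<and>
     (\<forall>k. \<forall>e\<in>carrier E. \<iota> k \<otimes>\<^bsub>E\<^esub> e = e \<otimes>\<^bsub>E\<^esub> \<iota> k)"

definition is_section ::
  "('g, 'm) monoid_scheme \<Rightarrow> ('e, 'k) monoid_scheme \<Rightarrow> ('e \<Rightarrow> 'g) \<Rightarrow> ('g \<Rightarrow> 'e) \<Rightarrow> bool" where
  "is_section G E \<phi> \<theta> \<longleftrightarrow> \<theta> \<in> carrier G \<rightarrow> carrier E \<and> (\<forall>g\<in>carrier G. \<phi> (\<theta> g) = g)"

definition is_section_cocycle ::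
  "('g, 'm) monoid_scheme \<Rightarrow> ('e, 'k) monoid_scheme \<Rightarrow> (int \<Rightarrow> 'e) \<Rightarrow> ('g \<Rightarrow> 'e) \<Rightarrow> ('g \<times> 'g \<Rightarrow> int) \<Rightarrow> bool" where
  "is_section_cocycle G E \<iota> \<theta> \<sigma> \<longleftrightarrow>
     \<sigma> \<in> carrier (C2 G integer_group) \<and>
     (\<forall>g\<in>carrier G. \<forall>h\<in>carrier G. \<iota> (\<sigma> (g, h)) = \<theta> g \<otimes>\<^bsub>E\<^esub> \<theta> h \<otimes>\<^bsub>E\<^esub> inv\<^bsub>E\<^esub> (\<theta> (g \<otimes>\<^bsub>G\<^esub> h)))"

text \<open>The class of the cocycle does not depend on the section, so asking for some section amounts
  to asking for all of them.\<close>

definition corresponds_to_extension ::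
  "('g, 'm) monoid_scheme \<Rightarrow> ('e, 'k) monoid_scheme \<Rightarrow> (int \<Rightarrow> 'e) \<Rightarrow> ('e \<Rightarrow> 'g) \<Rightarrow> ('g \<times> 'g \<Rightarrow> int) set \<Rightarrow> bool" where
  "corresponds_to_extension G E \<iota> \<phi> x \<longleftrightarrow>
     x \<in> carrier (cohomology2 G integer_group) \<and>
     (\<exists>\<theta> \<sigma>. is_section G E \<phi> \<theta> \<and> is_section_cocycle G E \<iota> \<theta> \<sigma> \<and> \<sigma> \<in> x)"


section \<open>Finite quotients\<close>

definition finite_quotient :: "('e, 'm) monoid_scheme \<Rightarrow> ('q, 'k) monoid_scheme \<Rightarrow> ('e \<Rightarrow> 'q) \<Rightarrow> bool" where
  "finite_quotient E Q q \<longleftrightarrow> group Q \<and> finite (carrier Q) \<and> q \<in> epi E Q"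

text \<open>The existential ranges over groups on the type of subsets of E only; this is no restriction,
  since every quotient of E is isomorphic to one of the form \<open>E Mod N\<close>.\<close>

definition finite_quotient_orders :: "'e monoid \<Rightarrow> 'e \<Rightarrow> nat set" where
  "finite_quotient_orders E z =
     {n. \<exists>(Q :: 'e set monoid) q. finite_quotient E Q q \<and> group.ord Q (q z) = n}"

text \<open>For a quotient map \<open>qt\<close> from E onto \<open>Qt\<close> and a normal subgroup H of \<open>Qt\<close> containing the image
  of the kernel of \<open>\<phi>\<close>, this is the map from G to \<open>Qt Mod H\<close> sending \<open>\<phi> e\<close> to the class of \<open>qt e\<close>.\<close>

definition induced_quotient_map ::
  "('e, 'm) monoid_scheme \<Rightarrow> ('e \<Rightarrow> 'g) \<Rightarrow> ('q, 'k) monoid_scheme \<Rightarrow> ('e \<Rightarrow> 'q) \<Rightarrow> 'q set \<Rightarrow> 'g \<Rightarrow> 'q set" where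
  "induced_quotient_map E \<phi> Qt qt H g = the_elem ((\<lambda>e. H #>\<^bsub>Qt\<^esub> qt e) ` {e \<in> carrier E. \<phi> e = g})"

definition n_Q_type ::
  "('g, 'm) monoid_scheme \<Rightarrow> nat \<Rightarrow> ('q, 'k) monoid_scheme \<Rightarrow> ('g \<Rightarrow> 'q) \<Rightarrow> ('g \<times> 'g \<Rightarrow> int) \<Rightarrow> bool" where
  "n_Q_type G n Q q \<tau> \<longleftrightarrow>
     \<tau> \<in> cocycles2 G integer_group \<and>
     (\<exists>\<tau>' \<in> cocycles2 Q (integer_mod_group n).
        \<forall>g\<in>carrier G. \<forall>h\<in>carrier G. \<tau> (g, h) mod int n = \<tau>' (q g, q h))"


section \<open>Finite-dimensional Hilbert spaces and induced representations\<close>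

text \<open>A Hilbert space is given as a linear subspace of a space of complex-valued functions (with
  pointwise operations) together with an inner product, linear in the first argument.\<close>

record 'a hilb =
  vecs :: "('a \<Rightarrow> complex) set"
  cinner :: "('a \<Rightarrow> complex) \<Rightarrow> ('a \<Rightarrow> complex) \<Rightarrow> complex"

definition unitary_iso :: "'a hilb \<Rightarrow> 'b hilb \<Rightarrow> (('a \<Rightarrow> complex) \<Rightarrow> ('b \<Rightarrow> complex)) \<Rightarrow> bool" where
  "unitary_iso V V' W \<longleftrightarrow>
     bij_betw W (vecs V) (vecs V') \<and>
     (\<forall>f\<in>vecs V. \<forall>f'\<in>vecs V. \<forall>a b. W (\<lambda>x. a * f x + b * f' x) = (\<lambda>y. a * W f y + b * W f' y)) \<and>
     (\<forall>f\<in>vecs V. \<forall>f'\<in>vecs V. cinner V' (W f) (W f') = cinner V f f')"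

text \<open>Only for finite B. Vectors vanish off B, so that they are determined by their values on B.\<close>

definition l2 :: "'a set \<Rightarrow> 'a hilb" where
  "l2 B = \<lparr>vecs = {f. \<forall>x. x \<notin> B \<longrightarrow> f x = 0}, cinner = (\<lambda>f f'. \<Sum>x\<in>B. f x * cnj (f' x))\<rparr>"

definition basis_vec :: "'a \<Rightarrow> 'a \<Rightarrow> complex" where
  "basis_vec c = (\<lambda>x. if x = c then 1 else 0)"

definition circle_group :: "complex monoid" where
  "circle_group = \<lparr>carrier = {z. cmod z = 1}, monoid.mult = (*), one = 1\<rparr>"

text \<open>The representation of a finite group K induced from a unitary character \<open>\<psi>\<close> of a subgroup H:
  K acts by left translation on the equivariant functions on K. The inner product is the sum over
  the left cosets of H: the summand is constant on these, whence the factor \<open>1 / card H\<close>.\<close>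

definition induced_space :: "('q, 'm) monoid_scheme \<Rightarrow> 'q set \<Rightarrow> ('q \<Rightarrow> complex) \<Rightarrow> 'q hilb" where
  "induced_space K H \<psi> =
     \<lparr>vecs = {f. (\<forall>x. x \<notin> carrier K \<longrightarrow> f x = 0) \<and>
                 (\<forall>x\<in>carrier K. \<forall>h\<in>H. f (x \<otimes>\<^bsub>K\<^esub> h) = inverse (\<psi> h) * f x)},
      cinner = (\<lambda>f f'. (\<Sum>x\<in>carrier K. f x * cnj (f' x)) / of_nat (card H))\<rparr>"

definition induced_rep :: "('q, 'm) monoid_scheme \<Rightarrow> 'q \<Rightarrow> ('q \<Rightarrow> complex) \<Rightarrow> ('q \<Rightarrow> complex)" where
  "induced_rep K y f = (\<lambda>x. if x \<in> carrier K then f (inv\<^bsub>K\<^esub> y \<otimes>\<^bsub>K\<^esub> x) else 0)"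

end

theory Submission
  imports Defs
begin

text \<open>
  Fix a transversal \<open>s\<close> of the cosets of the central subgroup generated by the image \<open>z\<close> of
  \<open>\<iota> 1\<close> in the finite quotient \<open>K\<close>. Multiplying by powers of \<open>\<iota> 1\<close>, the section \<open>\<theta>\<close> can be
  corrected to a section \<open>\<theta>n\<close> that lifts \<open>s\<close>, i.e. whose image in \<open>K\<close> factors through the
  quotient \<open>Q\<close> of \<open>K\<close>. The exponents are the values of \<open>\<alpha>n\<close>, and the cocycle \<open>\<sigma>n\<close> of \<open>\<theta>n\<close> reduces
  modulo \<open>n\<close> to the cocycle of \<open>s\<close>. The functions on \<open>K\<close> that are supported on one coset \<open>c\<close>, are
  equivariant and take the value 1 at \<open>s c\<close> form an orthonormal basis of the induced
  representation, and in this basis it acts by \<open>\<rho>\<close>, because \<open>z\<close> acts as the scalar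
  \<open>exp (2\<pi>i/n)\<close>.
\<close>

section \<open>Cocycles of sections\<close>

lemma section_cocycle_in_cocycles2:
  assumes "group G" "group E" "comm_group A"
    and \<iota>: "\<iota> \<in> hom A E" "inj_on \<iota> (carrier A)"
    and central: "\<And>a e. \<lbrakk>a \<in> carrier A; e \<in> carrier E\<rbrakk> \<Longrightarrow> \<iota> a \<otimes>\<^bsub>E\<^esub> e = e \<otimes>\<^bsub>E\<^esub> \<iota> a"
    and \<theta>: "\<And>g. g \<in> carrier G \<Longrightarrow> \<theta> g \<in> carrier E"
    and \<sigma>: "\<sigma> \<in> carrier (C2 G A)"
    and factor: "\<And>g h. \<lbrakk>g \<in> carrier G; h \<in> carrier G\<rbrakk>
          \<Longrightarrow> \<theta> g \<otimes>\<^bsub>E\<^esub> \<theta> h = \<iota> (\<sigma> (g, h)) \<otimes>\<^bsub>E\<^esub> \<theta> (g \<otimes>\<^bsub>G\<^esub> h)"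
  shows "\<sigma> \<in> cocycles2 G A"
proof -
  interpret G: group G by fact
  interpret E: group E by fact
  interpret A: comm_group A by fact
  have \<sigma>_closed [simp]: "\<sigma> (g, h) \<in> carrier A" if "g \<in> carrier G" "h \<in> carrier G" for g h
    using \<sigma> that by (auto simp: C2_def PiE_iff)
  have \<iota>_closed [simp]: "\<iota> a \<in> carrier E" if "a \<in> carrier A" for a
    using \<iota>(1) that by (auto simp: hom_def)
  have \<iota>_mult: "\<iota> (a \<otimes>\<^bsub>A\<^esub> b) = \<iota> a \<otimes>\<^bsub>E\<^esub> \<iota> b" if "a \<in> carrier A" "b \<in> carrier A" for a b
    using \<iota>(1) that by (auto simp: hom_def)
  note \<theta> [simp]
  have eq: "\<sigma> (h, k) \<otimes>\<^bsub>A\<^esub> \<sigma> (g, h \<otimes>\<^bsub>G\<^esub> k) = \<sigma> (g, h) \<otimes>\<^bsub>A\<^esub> \<sigma> (g \<otimes>\<^bsub>G\<^esub> h, k)"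
    if [simp]: "g \<in> carrier G" "h \<in> carrier G" "k \<in> carrier G" for g h k
  proof -
    let ?t = "\<theta> (g \<otimes>\<^bsub>G\<^esub> h \<otimes>\<^bsub>G\<^esub> k)"
    have "\<iota> (\<sigma> (g, h) \<otimes>\<^bsub>A\<^esub> \<sigma> (g \<otimes>\<^bsub>G\<^esub> h, k)) \<otimes>\<^bsub>E\<^esub> ?t
        = \<iota> (\<sigma> (g, h)) \<otimes>\<^bsub>E\<^esub> (\<theta> (g \<otimes>\<^bsub>G\<^esub> h) \<otimes>\<^bsub>E\<^esub> \<theta> k)"
      by (simp add: \<iota>_mult factor E.m_assoc)
    also have "\<dots> = \<theta> g \<otimes>\<^bsub>E\<^esub> \<theta> h \<otimes>\<^bsub>E\<^esub> \<theta> k"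
      by (simp add: factor[of g h] E.m_assoc [symmetric])
    also have "\<dots> = \<theta> g \<otimes>\<^bsub>E\<^esub> (\<iota> (\<sigma> (h, k)) \<otimes>\<^bsub>E\<^esub> \<theta> (h \<otimes>\<^bsub>G\<^esub> k))"
      by (simp add: E.m_assoc factor[of h k])
    also have "\<dots> = \<iota> (\<sigma> (h, k)) \<otimes>\<^bsub>E\<^esub> (\<theta> g \<otimes>\<^bsub>E\<^esub> \<theta> (h \<otimes>\<^bsub>G\<^esub> k))"
      using central[of "\<sigma> (h, k)" "\<theta> g"] by (simp add: E.m_assoc [symmetric])
    also have "\<dots> = \<iota> (\<sigma> (h, k) \<otimes>\<^bsub>A\<^esub> \<sigma> (g, h \<otimes>\<^bsub>G\<^esub> k)) \<otimes>\<^bsub>E\<^esub> ?t"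
      by (simp add: factor \<iota>_mult E.m_assoc G.m_assoc)
    finally have "\<iota> (\<sigma> (g, h) \<otimes>\<^bsub>A\<^esub> \<sigma> (g \<otimes>\<^bsub>G\<^esub> h, k)) = \<iota> (\<sigma> (h, k) \<otimes>\<^bsub>A\<^esub> \<sigma> (g, h \<otimes>\<^bsub>G\<^esub> k))"
      by simp
    with \<iota>(2) show ?thesis
      by (auto dest: inj_onD)
  qed
  have "\<sigma> (h, k) \<otimes>\<^bsub>A\<^esub> inv\<^bsub>A\<^esub> (\<sigma> (g \<otimes>\<^bsub>G\<^esub> h, k)) \<otimes>\<^bsub>A\<^esub> \<sigma> (g, h \<otimes>\<^bsub>G\<^esub> k) \<otimes>\<^bsub>A\<^esub> inv\<^bsub>A\<^esub> (\<sigma> (g, h)) = \<one>\<^bsub>A\<^esub>"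
    if [simp]: "g \<in> carrier G" "h \<in> carrier G" "k \<in> carrier G" for g h k
  proof -
    have "\<sigma> (h, k) \<otimes>\<^bsub>A\<^esub> inv\<^bsub>A\<^esub> (\<sigma> (g \<otimes>\<^bsub>G\<^esub> h, k)) \<otimes>\<^bsub>A\<^esub> \<sigma> (g, h \<otimes>\<^bsub>G\<^esub> k) \<otimes>\<^bsub>A\<^esub> inv\<^bsub>A\<^esub> (\<sigma> (g, h))
      = (\<sigma> (h, k) \<otimes>\<^bsub>A\<^esub> \<sigma> (g, h \<otimes>\<^bsub>G\<^esub> k)) \<otimes>\<^bsub>A\<^esub> inv\<^bsub>A\<^esub> (\<sigma> (g, h) \<otimes>\<^bsub>A\<^esub> \<sigma> (g \<otimes>\<^bsub>G\<^esub> h, k))"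
      by (simp add: A.inv_mult_group A.m_ac)
    then show ?thesis
      by (simp add: eq)
  qed
  then show ?thesis
    using \<sigma> by (auto simp: cocycles2_def kernel_def cobd2_def C3_def intro!: restrict_ext)
qed

lemma mult_cobd1:
  assumes "\<alpha> \<in> carrier (C1 G integer_group)" "\<beta> \<in> carrier (C1 G integer_group)" "group G"
  shows "cobd1 G integer_group (\<alpha> \<otimes>\<^bsub>C1 G integer_group\<^esub> \<beta>)
       = cobd1 G integer_group \<alpha> \<otimes>\<^bsub>C2 G integer_group\<^esub> cobd1 G integer_group \<beta>"
proof -
  interpret group G by fact
  show ?thesis
    by (rule ext) (simp add: cobd1_def C1_def C2_def split: prod.split)
qed

locale integral_central_extension =
  fixes G :: "('g, 'm) monoid_scheme" and E :: "('e, 'k) monoid_scheme"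
    and \<iota> :: "int \<Rightarrow> 'e" and \<phi> :: "'e \<Rightarrow> 'g"
  assumes ext: "central_extension G E \<iota> \<phi>"
begin

sublocale G: group G using ext by (simp add: central_extension_def)
sublocale E: group E using ext by (simp add: central_extension_def)

lemma \<iota>_mon: "\<iota> \<in> mon integer_group E"
  and \<phi>_epi: "\<phi> \<in> epi E G"
  and kernel_\<phi>: "kernel E G \<phi> = range \<iota>"
  and \<iota>_central: "e \<in> carrier E \<Longrightarrow> e \<otimes>\<^bsub>E\<^esub> \<iota> k = \<iota> k \<otimes>\<^bsub>E\<^esub> e"
  using ext unfolding central_extension_def by metis+

lemma \<iota>_closed [simp]: "\<iota> k \<in> carrier E"
  using \<iota>_mon by (auto simp: mon_def hom_def)

lemma \<iota>_add: "\<iota> (k + l) = \<iota> k \<otimes>\<^bsub>E\<^esub> \<iota> l"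
  using \<iota>_mon by (auto simp: mon_def hom_def)

lemma \<iota>_eq_iff [simp]: "\<iota> k = \<iota> l \<longleftrightarrow> k = l"
  using \<iota>_mon by (auto simp: mon_def inj_on_def)

lemma \<phi>_closed [simp]: "e \<in> carrier E \<Longrightarrow> \<phi> e \<in> carrier G"
  using \<phi>_epi by (auto simp: epi_def hom_def)

lemma \<phi>_mult [simp]: "\<lbrakk>e \<in> carrier E; f \<in> carrier E\<rbrakk> \<Longrightarrow> \<phi> (e \<otimes>\<^bsub>E\<^esub> f) = \<phi> e \<otimes>\<^bsub>G\<^esub> \<phi> f"
  using \<phi>_epi by (auto simp: epi_def hom_def)

lemma \<phi>_surj: "g \<in> carrier G \<Longrightarrow> \<exists>e\<in>carrier E. \<phi> e = g"
proof -
  assume "g \<in> carrier G"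
  then have "g \<in> \<phi> ` carrier E"
    using \<phi>_epi by (simp add: epi_def)
  then show ?thesis
    by blast
qed

lemma \<phi>_\<iota> [simp]: "\<phi> (\<iota> k) = \<one>\<^bsub>G\<^esub>"
proof -
  have "\<iota> k \<in> kernel E G \<phi>"
    by (simp add: kernel_\<phi>)
  then show ?thesis
    by (simp add: kernel_def)
qed

lemma \<phi>_eqD:
  assumes "e \<in> carrier E" "f \<in> carrier E" "\<phi> e = \<phi> f"
  obtains k where "e = \<iota> k \<otimes>\<^bsub>E\<^esub> f"
proof -
  have "\<phi> (e \<otimes>\<^bsub>E\<^esub> inv\<^bsub>E\<^esub> f) \<otimes>\<^bsub>G\<^esub> \<phi> f = \<phi> f"
    using assms by (simp flip: \<phi>_mult add: E.m_assoc)
  then have "\<phi> (e \<otimes>\<^bsub>E\<^esub> inv\<^bsub>E\<^esub> f) = \<one>\<^bsub>G\<^esub>"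
    using assms by (metis E.inv_closed E.m_closed G.r_cancel_one \<phi>_closed)
  then have "e \<otimes>\<^bsub>E\<^esub> inv\<^bsub>E\<^esub> f \<in> kernel E G \<phi>"
    using assms by (simp add: kernel_def)
  then obtain k where "e \<otimes>\<^bsub>E\<^esub> inv\<^bsub>E\<^esub> f = \<iota> k"
    by (auto simp: kernel_\<phi>)
  then have "e = \<iota> k \<otimes>\<^bsub>E\<^esub> f"
    using assms by (metis E.inv_solve_right \<iota>_closed)
  then show thesis by (rule that)
qed

lemma section_closed: "is_section G E \<phi> \<theta> \<Longrightarrow> g \<in> carrier G \<Longrightarrow> \<theta> g \<in> carrier E"
  by (auto simp: is_section_def)

lemma section_cocycle_iff:
  assumes "is_section G E \<phi> \<theta>"
  shows "is_section_cocycle G E \<iota> \<theta> \<sigma> \<longleftrightarrow> \<sigma> \<in> carrier (C2 G integer_group) \<and>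
    (\<forall>g\<in>carrier G. \<forall>h\<in>carrier G. \<theta> g \<otimes>\<^bsub>E\<^esub> \<theta> h = \<iota> (\<sigma> (g, h)) \<otimes>\<^bsub>E\<^esub> \<theta> (g \<otimes>\<^bsub>G\<^esub> h))"
  unfolding is_section_cocycle_def
  using section_closed[OF assms] by (auto simp: E.inv_solve_right)

lemma ex_section_cocycle:
  assumes sec: "is_section G E \<phi> \<theta>"
  obtains \<sigma> where "is_section_cocycle G E \<iota> \<theta> \<sigma>"
proof -
  have "\<forall>p\<in>carrier G \<times> carrier G. \<exists>k.
      \<theta> (fst p) \<otimes>\<^bsub>E\<^esub> \<theta> (snd p) = \<iota> k \<otimes>\<^bsub>E\<^esub> \<theta> (fst p \<otimes>\<^bsub>G\<^esub> snd p)"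
  proof
    fix p assume p: "p \<in> carrier G \<times> carrier G"
    have "\<phi> (\<theta> (fst p) \<otimes>\<^bsub>E\<^esub> \<theta> (snd p)) = \<phi> (\<theta> (fst p \<otimes>\<^bsub>G\<^esub> snd p))"
      using sec p by (auto simp: is_section_def Pi_iff)
    with p show "\<exists>k. \<theta> (fst p) \<otimes>\<^bsub>E\<^esub> \<theta> (snd p) = \<iota> k \<otimes>\<^bsub>E\<^esub> \<theta> (fst p \<otimes>\<^bsub>G\<^esub> snd p)"
      by (auto intro!: section_closed[OF sec] elim!: \<phi>_eqD[rotated 2])
  qed
  then obtain \<sigma> where "\<forall>p\<in>carrier G \<times> carrier G.
      \<theta> (fst p) \<otimes>\<^bsub>E\<^esub> \<theta> (snd p) = \<iota> (\<sigma> p) \<otimes>\<^bsub>E\<^esub> \<theta> (fst p \<otimes>\<^bsub>G\<^esub> snd p)"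
    by metis
  then have "is_section_cocycle G E \<iota> \<theta> (restrict \<sigma> (carrier G \<times> carrier G))"
    unfolding section_cocycle_iff[OF sec] by (auto simp: C2_def)
  then show thesis by (rule that)
qed

lemma section_cocycle_cocycle:
  assumes "is_section G E \<phi> \<theta>" "is_section_cocycle G E \<iota> \<theta> \<sigma>"
  shows "\<sigma> \<in> cocycles2 G integer_group"
proof (rule section_cocycle_in_cocycles2[where E = E and \<iota> = \<iota> and \<theta> = \<theta>])
  show "comm_group integer_group" by (rule abelian_integer_group)
next
  show "\<iota> k \<otimes>\<^bsub>E\<^esub> e = e \<otimes>\<^bsub>E\<^esub> \<iota> k" if "e \<in> carrier E" for k e
    by (rule \<iota>_central[OF that, symmetric])
qed (use assms section_closed in
      \<open>auto simp: section_cocycle_iff[OF assms(1)] hom_def \<iota>_add inj_on_def\<close>)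

lemma sections_differ:
  assumes "is_section G E \<phi> \<theta>" "is_section G E \<phi> \<theta>'"
  obtains \<alpha> where "\<alpha> \<in> carrier (C1 G integer_group)"
    and "\<And>g. g \<in> carrier G \<Longrightarrow> \<theta> g = \<iota> (\<alpha> g) \<otimes>\<^bsub>E\<^esub> \<theta>' g"
proof -
  have "\<forall>g\<in>carrier G. \<exists>k. \<theta> g = \<iota> k \<otimes>\<^bsub>E\<^esub> \<theta>' g"
  proof
    fix g assume "g \<in> carrier G"
    then have "\<theta> g \<in> carrier E" "\<theta>' g \<in> carrier E" "\<phi> (\<theta> g) = \<phi> (\<theta>' g)"
      using assms by (auto simp: is_section_def)
    then show "\<exists>k. \<theta> g = \<iota> k \<otimes>\<^bsub>E\<^esub> \<theta>' g"
      by (metis \<phi>_eqD)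
  qed
  then obtain \<alpha> where "\<forall>g\<in>carrier G. \<theta> g = \<iota> (\<alpha> g) \<otimes>\<^bsub>E\<^esub> \<theta>' g"
    by metis
  then show thesis
    by (intro that[of "restrict \<alpha> (carrier G)"]) (auto simp: C1_def)
qed

lemma section_cocycles_cohomologous:
  assumes sec: "is_section G E \<phi> \<theta>" and sec': "is_section G E \<phi> \<theta>'"
    and \<sigma>: "is_section_cocycle G E \<iota> \<theta> \<sigma>" and \<sigma>': "is_section_cocycle G E \<iota> \<theta>' \<sigma>'"
    and \<alpha>: "\<And>g. g \<in> carrier G \<Longrightarrow> \<theta> g = \<iota> (\<alpha> g) \<otimes>\<^bsub>E\<^esub> \<theta>' g"
  shows "\<sigma>' \<otimes>\<^bsub>C2 G integer_group\<^esub> cobd1 G integer_group \<alpha> = \<sigma>"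
proof -
  note [simp] = section_closed[OF sec] section_closed[OF sec']
  have eq: "\<sigma> (g, h) = \<sigma>' (g, h) + (\<alpha> h - \<alpha> (g \<otimes>\<^bsub>G\<^esub> h) + \<alpha> g)"
    if [simp]: "g \<in> carrier G" "h \<in> carrier G" for g h
  proof -
    let ?t = "\<theta>' (g \<otimes>\<^bsub>G\<^esub> h)"
    have "\<iota> (\<sigma> (g, h) + \<alpha> (g \<otimes>\<^bsub>G\<^esub> h)) \<otimes>\<^bsub>E\<^esub> ?t = \<iota> (\<sigma> (g, h)) \<otimes>\<^bsub>E\<^esub> \<theta> (g \<otimes>\<^bsub>G\<^esub> h)"
      by (simp add: \<iota>_add \<alpha>[of "g \<otimes>\<^bsub>G\<^esub> h"] E.m_assoc)
    also have "\<dots> = \<theta> g \<otimes>\<^bsub>E\<^esub> \<theta> h"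
      using \<sigma> by (simp add: section_cocycle_iff[OF sec])
    also have "\<dots> = \<iota> (\<alpha> g) \<otimes>\<^bsub>E\<^esub> (\<theta>' g \<otimes>\<^bsub>E\<^esub> \<iota> (\<alpha> h)) \<otimes>\<^bsub>E\<^esub> \<theta>' h"
      by (simp add: \<alpha> E.m_assoc)
    also have "\<dots> = \<iota> (\<alpha> g) \<otimes>\<^bsub>E\<^esub> \<iota> (\<alpha> h) \<otimes>\<^bsub>E\<^esub> (\<theta>' g \<otimes>\<^bsub>E\<^esub> \<theta>' h)"
      by (subst \<iota>_central) (simp_all add: E.m_assoc)
    also have "\<dots> = \<iota> (\<alpha> g + \<alpha> h + \<sigma>' (g, h)) \<otimes>\<^bsub>E\<^esub> ?t"
      using \<sigma>' by (simp add: section_cocycle_iff[OF sec'] \<iota>_add E.m_assoc)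
    finally show ?thesis
      by simp
  qed
  have "\<sigma> \<in> extensional (carrier G \<times> carrier G)"
    using \<sigma> by (auto simp: is_section_cocycle_def C2_def PiE_def)
  then show ?thesis
    using eq by (auto simp: C2_def cobd1_def extensional_def fun_eq_iff restrict_def)
qed

lemma section_cocycle_in_class:
  assumes x: "corresponds_to_extension G E \<iota> \<phi> x"
    and sec: "is_section G E \<phi> \<theta>" "is_section_cocycle G E \<iota> \<theta> \<sigma>"
  shows "\<sigma> \<in> x"
proof -
  let ?C2 = "C2 G integer_group" and ?d = "cobd1 G integer_group"
  obtain \<theta>' \<sigma>' where \<theta>': "is_section G E \<phi> \<theta>'" "is_section_cocycle G E \<iota> \<theta>' \<sigma>'" and "\<sigma>' \<in> x"
    using x by (auto simp: corresponds_to_extension_def)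
  obtain a where a: "x = coboundaries2 G integer_group #>\<^bsub>?C2\<lparr>carrier := cocycles2 G integer_group\<rparr>\<^esub> a"
    and "a \<in> cocycles2 G integer_group"
    using x by (auto simp: corresponds_to_extension_def cohomology2_def FactGroup_def RCOSETS_def)
  then have a_closed: "a \<in> carrier ?C2"
    by (simp add: cocycles2_def kernel_def)
  obtain \<beta> where \<beta>: "\<beta> \<in> carrier (C1 G integer_group)" and \<sigma>'_eq: "\<sigma>' = ?d \<beta> \<otimes>\<^bsub>?C2\<^esub> a"
    using \<open>\<sigma>' \<in> x\<close> unfolding a by (auto simp: r_coset_def coboundaries2_def)
  obtain \<alpha> where \<alpha>: "\<alpha> \<in> carrier (C1 G integer_group)"
    and "\<And>g. g \<in> carrier G \<Longrightarrow> \<theta> g = \<iota> (\<alpha> g) \<otimes>\<^bsub>E\<^esub> \<theta>' g"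
    using sections_differ[OF sec(1) \<theta>'(1)] by blast
  then have "\<sigma> = \<sigma>' \<otimes>\<^bsub>?C2\<^esub> ?d \<alpha>"
    using section_cocycles_cohomologous[OF sec(1) \<theta>'(1) sec(2) \<theta>'(2)] by simp
  also have "\<dots> = ?d (\<beta> \<otimes>\<^bsub>C1 G integer_group\<^esub> \<alpha>) \<otimes>\<^bsub>?C2\<^esub> a"
    by (simp add: \<sigma>'_eq mult_cobd1[OF \<beta> \<alpha> G.is_group]) (auto simp: C2_def fun_eq_iff restrict_def)
  finally show ?thesis
    using \<alpha> \<beta> unfolding a by (auto simp: r_coset_def coboundaries2_def intro!: bexI imageI) (auto simp: C1_def)
qed

lemma induced_quotient_map_eq:
  assumes Q: "group Q" "q \<in> hom E Q" and H: "subgroup H Q" "\<And>k. q (\<iota> k) \<in> H" and e: "e \<in> carrier E"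
  shows "induced_quotient_map E \<phi> Q q H (\<phi> e) = H #>\<^bsub>Q\<^esub> q e"
proof -
  interpret Q: group Q by fact
  have "H #>\<^bsub>Q\<^esub> q f = H #>\<^bsub>Q\<^esub> q e" if f: "f \<in> carrier E" "\<phi> f = \<phi> e" for f
  proof -
    obtain k where "f = \<iota> k \<otimes>\<^bsub>E\<^esub> e"
      using \<phi>_eqD[OF f(1) e f(2)] .
    then have "H #>\<^bsub>Q\<^esub> q f = H #>\<^bsub>Q\<^esub> (q (\<iota> k) \<otimes>\<^bsub>Q\<^esub> q e)"
      using Q(2) e by (simp add: hom_def)
    also have "\<dots> = H #>\<^bsub>Q\<^esub> q (\<iota> k) #>\<^bsub>Q\<^esub> q e"
      using Q(2) e H(1) by (subst Q.coset_mult_assoc) (auto simp: hom_def Pi_iff dest: subgroup.subset)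
    also have "\<dots> = H #>\<^bsub>Q\<^esub> q e"
      using H by (simp add: Q.coset_join2 subgroup.mem_carrier)
    finally show ?thesis .
  qed
  then have "(\<lambda>f. H #>\<^bsub>Q\<^esub> q f) ` {f \<in> carrier E. \<phi> f = \<phi> e}
      = (\<lambda>_. H #>\<^bsub>Q\<^esub> q e) ` {f \<in> carrier E. \<phi> f = \<phi> e}"
    by (intro image_cong) simp_all
  also have "\<dots> = {H #>\<^bsub>Q\<^esub> q e}"
    using e by auto
  finally show ?thesis
    by (simp add: induced_quotient_map_def)
qed

end

section \<open>Unitary isomorphisms\<close>

lemma unitary_iso_comp:
  assumes U: "unitary_iso V V' U" and U': "unitary_iso V' V'' U'"
  shows "unitary_iso V V'' (\<lambda>v. U' (U v))"
proof -
  have "U v \<in> vecs V'" if "v \<in> vecs V" for v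
    using U that by (auto simp: unitary_iso_def dest: bij_betwE)
  then show ?thesis
    using assms bij_betw_trans[of U "vecs V" "vecs V'" U' "vecs V''"]
    by (simp add: unitary_iso_def o_def)
qed

lemma unitary_iso_inv:
  assumes U: "unitary_iso V V' U"
    and lin: "\<And>a b f f'. \<lbrakk>f \<in> vecs V; f' \<in> vecs V\<rbrakk> \<Longrightarrow> (\<lambda>x. a * f x + b * f' x) \<in> vecs V"
  shows "unitary_iso V' V (inv_into (vecs V) U)"
proof -
  let ?U' = "inv_into (vecs V) U"
  have bij: "bij_betw U (vecs V) (vecs V')"
    using U by (simp add: unitary_iso_def)
  have closed [simp]: "?U' v \<in> vecs V" and inv [simp]: "U (?U' v) = v" if "v \<in> vecs V'" for v
    using bij that by (auto simp: bij_betw_def inv_into_into f_inv_into_f)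
  have "?U' (\<lambda>x. a * f x + b * f' x) = (\<lambda>y. a * ?U' f y + b * ?U' f' y)"
    if [simp]: "f \<in> vecs V'" "f' \<in> vecs V'" for a b f f'
  proof (rule inv_into_f_eq)
    show "U (\<lambda>y. a * ?U' f y + b * ?U' f' y) = (\<lambda>x. a * f x + b * f' x)"
      using U by (simp add: unitary_iso_def)
  qed (use bij lin in \<open>auto simp: bij_betw_def\<close>)
  moreover have "cinner V (?U' f) (?U' f') = cinner V' f f'"
    if [simp]: "f \<in> vecs V'" "f' \<in> vecs V'" for f f'
  proof -
    have "cinner V' (U (?U' f)) (U (?U' f')) = cinner V (?U' f) (?U' f')"
      using U closed that unfolding unitary_iso_def by blast
    then show ?thesis by simp
  qed
  ultimately show ?thesis
    using bij by (simp add: unitary_iso_def bij_betw_inv_into)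
qed

section \<open>Representations induced from a character of a central subgroup\<close>

locale central_character = group K for K :: "('q, 'm) monoid_scheme" (structure) +
  fixes H :: "'q set" and \<psi> :: "'q \<Rightarrow> complex" and s :: "'q set \<Rightarrow> 'q"
  assumes finite_K: "finite (carrier K)"
    and H: "subgroup H K"
    and central: "\<And>h y. \<lbrakk>h \<in> H; y \<in> carrier K\<rbrakk> \<Longrightarrow> y \<otimes> h = h \<otimes> y"
    and \<psi>: "\<psi> \<in> hom (K\<lparr>carrier := H\<rparr>) circle_group"
    and s: "\<And>c. c \<in> carrier (K Mod H) \<Longrightarrow> s c \<in> c"
begin

lemma H_closed [simp]: "h \<in> H \<Longrightarrow> h \<in> carrier K"
  using H subgroup.mem_carrier by fastforce

lemma H_mult [simp]: "\<lbrakk>h \<in> H; h' \<in> H\<rbrakk> \<Longrightarrow> h \<otimes> h' \<in> H"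
  using H by (simp add: subgroup.m_closed)

sublocale N: normal H K
  by (rule normalI[OF H]) (auto simp: r_coset_def l_coset_def intro: central[symmetric] central)

sublocale Q: group "K Mod H"
  by (rule N.factorgroup_is_group)

lemma coset_closed [simp]: "y \<in> carrier K \<Longrightarrow> H #> y \<in> carrier (K Mod H)"
  by (auto simp: FactGroup_def RCOSETS_def)

lemma ex_coset: "c \<in> carrier (K Mod H) \<Longrightarrow> \<exists>y\<in>carrier K. c = H #> y"
  by (auto simp: FactGroup_def RCOSETS_def)

lemma coset_mult:
  "\<lbrakk>y \<in> carrier K; w \<in> carrier K\<rbrakk> \<Longrightarrow> (H #> y) \<otimes>\<^bsub>K Mod H\<^esub> (H #> w) = H #> (y \<otimes> w)"
  by (simp add: FactGroup_def N.rcos_sum)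

lemma coset_absorb [simp]: "\<lbrakk>h \<in> H; y \<in> carrier K\<rbrakk> \<Longrightarrow> H #> (h \<otimes> y) = H #> y"
  using H coset_join2[of h H] coset_mult_assoc[of H h y] N.subset by simp

lemma coset_eqD:
  assumes "y \<in> carrier K" "w \<in> carrier K" "H #> y = H #> w"
  obtains h where "h \<in> H" "y = h \<otimes> w"
  using assms rcos_self[OF assms(1) H] by (auto simp: r_coset_def)

lemma s_closed [simp]: "c \<in> carrier (K Mod H) \<Longrightarrow> s c \<in> carrier K"
  using s[of c] ex_coset[of c] r_coset_subset_G[OF N.subset] by blast

lemma coset_s [simp]: "c \<in> carrier (K Mod H) \<Longrightarrow> H #> s c = c"
  using s[of c] ex_coset[of c] repr_independence[of "s c" H] H by auto

lemma \<psi>_mult: "\<lbrakk>h \<in> H; h' \<in> H\<rbrakk> \<Longrightarrow> \<psi> (h \<otimes> h') = \<psi> h * \<psi> h'"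
  using \<psi> by (simp add: hom_def circle_group_def)

lemma norm_\<psi>: "h \<in> H \<Longrightarrow> cmod (\<psi> h) = 1"
  using \<psi> by (auto simp: hom_def circle_group_def)

lemma \<psi>_nz [simp]: "h \<in> H \<Longrightarrow> \<psi> h \<noteq> 0"
  using norm_\<psi>[of h] by auto

lemma \<psi>_one [simp]: "\<psi> \<one> = 1"
proof -
  have "\<psi> \<one> = \<psi> \<one> * \<psi> \<one>"
    using \<psi>_mult[of \<one> \<one>] H subgroup.one_closed by fastforce
  then show ?thesis
    using \<psi>_nz[OF subgroup.one_closed[OF H]] by simp
qed

abbreviation "\<H> \<equiv> l2 (carrier (K Mod H))"
abbreviation "\<I> \<equiv> induced_space K H \<psi>"

text \<open>The equivariant function with value 1 on the transversal; multiplication by it turns functions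
  on the quotient into vectors of the induced space.\<close>

definition phase :: "'q \<Rightarrow> complex" where
  "phase y = inverse (\<psi> (y \<otimes> inv (s (H #> y))))"

definition intertwiner :: "('q set \<Rightarrow> complex) \<Rightarrow> 'q \<Rightarrow> complex" where
  "intertwiner v = (\<lambda>y. if y \<in> carrier K then v (H #> y) * phase y else 0)"

lemma phase_eq: "\<lbrakk>h \<in> H; c \<in> carrier (K Mod H)\<rbrakk> \<Longrightarrow> phase (h \<otimes> s c) = inverse (\<psi> h)"
  by (simp add: phase_def m_assoc)

lemma coset_factor:
  assumes "y \<in> carrier K"
  obtains h where "h \<in> H" "y = h \<otimes> s (H #> y)"
  using coset_eqD[OF assms, of "s (H #> y)"] assms by auto

lemma norm_phase: "y \<in> carrier K \<Longrightarrow> cmod (phase y) = 1"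
  by (metis coset_factor coset_closed phase_eq norm_\<psi> norm_inverse inverse_1)

lemma phase_cnj: "y \<in> carrier K \<Longrightarrow> phase y * cnj (phase y) = 1"
  by (simp add: complex_mult_cnj norm_phase flip: cmod_power2)

lemma phase_mult:
  assumes y: "y \<in> carrier K" and h: "h \<in> H"
  shows "phase (y \<otimes> h) = inverse (\<psi> h) * phase y"
proof -
  obtain k where k: "k \<in> H" "y = k \<otimes> s (H #> y)"
    using coset_factor[OF y] .
  have "phase (y \<otimes> h) = phase ((h \<otimes> k) \<otimes> s (H #> y))"
    using k y h central[OF h y] by (metis m_assoc H_closed s_closed coset_closed)
  also have "\<dots> = inverse (\<psi> h) * phase (k \<otimes> s (H #> y))"
    using k(1) y h by (simp add: phase_eq \<psi>_mult)
  finally show ?thesis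
    using k(2) by simp
qed

lemma sum_coset: "(\<Sum>y\<in>carrier K. F (H #> y)) = of_nat (card H) * (\<Sum>c\<in>carrier (K Mod H). F c)"
  for F :: "'q set \<Rightarrow> complex"
proof -
  have fin: "finite (carrier (K Mod H))"
    using finite_K by (simp add: FactGroup_def RCOSETS_def)
  have fibre: "{y \<in> carrier K. H #> y = c} = c" if c: "c \<in> carrier (K Mod H)" for c
  proof -
    obtain w where w: "w \<in> carrier K" "c = H #> w"
      using ex_coset[OF c] by blast
    have "y \<in> c \<longleftrightarrow> y \<in> carrier K \<and> H #> y = c" for y
      using rcos_self[OF _ H, of y] r_coset_subset_G[OF N.subset w(1)] repr_independence[OF _ w(1) H, of y]
      unfolding w(2) by blast
    then show ?thesis by blast
  qed
  have card: "card c = card H" if "c \<in> carrier (K Mod H)" for c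
    using that card_rcosets_equal[of c H] N.subset finite_K
    by (simp add: FactGroup_def)
  have "(\<Sum>y\<in>carrier K. F (H #> y))
      = (\<Sum>c\<in>carrier (K Mod H). \<Sum>y\<in>{y \<in> carrier K. H #> y = c}. F (H #> y))"
    by (rule sum.group[symmetric]) (auto simp: finite_K fin)
  also have "\<dots> = (\<Sum>c\<in>carrier (K Mod H). of_nat (card H) * F c)"
  proof (rule sum.cong[OF refl])
    fix c assume c: "c \<in> carrier (K Mod H)"
    have "(\<Sum>y\<in>{y \<in> carrier K. H #> y = c}. F (H #> y)) = (\<Sum>y\<in>{y \<in> carrier K. H #> y = c}. F c)"
      by simp
    then show "(\<Sum>y\<in>{y \<in> carrier K. H #> y = c}. F (H #> y)) = of_nat (card H) * F c"
      using fibre[OF c] card[OF c] by simp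
  qed
  finally show ?thesis
    by (simp add: sum_distrib_left)
qed

lemma intertwiner_closed: "intertwiner v \<in> vecs \<I>"
proof -
  have "intertwiner v (y \<otimes> h) = inverse (\<psi> h) * intertwiner v y" if "y \<in> carrier K" "h \<in> H" for y h
    using that coset_absorb[OF that(2,1), folded central[OF that(2,1)]] by (simp add: intertwiner_def phase_mult)
  then show ?thesis
    by (simp add: induced_space_def) (simp add: intertwiner_def)
qed

lemma intertwiner_bij: "bij_betw intertwiner (vecs \<H>) (vecs \<I>)"
proof (rule bij_betw_byWitness[where f' = "\<lambda>f c. if c \<in> carrier (K Mod H) then f (s c) else 0"])
  have phase_s: "phase (s c) = 1" if "c \<in> carrier (K Mod H)" for c
    using that by (simp add: phase_def)
  show "\<forall>v\<in>vecs \<H>. (\<lambda>c. if c \<in> carrier (K Mod H) then intertwiner v (s c) else 0) = v"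
    by (auto simp: l2_def intertwiner_def phase_s fun_eq_iff)
  show "\<forall>f\<in>vecs \<I>. intertwiner (\<lambda>c. if c \<in> carrier (K Mod H) then f (s c) else 0) = f"
  proof (intro ballI ext)
    fix f y assume f: "f \<in> vecs \<I>"
    show "intertwiner (\<lambda>c. if c \<in> carrier (K Mod H) then f (s c) else 0) y = f y"
    proof (cases "y \<in> carrier K")
      case True
      then obtain h where h: "h \<in> H" "y = h \<otimes> s (H #> y)"
        by (rule coset_factor)
      have "f y = f (s (H #> y) \<otimes> h)"
        using h True by (metis central s_closed coset_closed)
      also have "\<dots> = inverse (\<psi> h) * f (s (H #> y))"
        using f h(1) True by (simp add: induced_space_def)
      also have "inverse (\<psi> h) = phase y"
        using h True by (metis phase_eq coset_closed)
      finally show ?thesis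
        using True by (simp add: intertwiner_def)
    qed (use f in \<open>simp add: intertwiner_def induced_space_def\<close>)
  qed
  show "intertwiner ` vecs \<H> \<subseteq> vecs \<I>"
    using intertwiner_closed by blast
  show "(\<lambda>f c. if c \<in> carrier (K Mod H) then f (s c) else 0) ` vecs \<I> \<subseteq> vecs \<H>"
    by (auto simp: l2_def)
qed

lemma intertwiner_unitary: "unitary_iso \<H> \<I> intertwiner"
proof -
  have "cinner \<I> (intertwiner f) (intertwiner f') = cinner \<H> f f'" for f f'
  proof -
    have "(\<Sum>y\<in>carrier K. intertwiner f y * cnj (intertwiner f' y))
        = (\<Sum>y\<in>carrier K. (\<lambda>c. f c * cnj (f' c)) (H #> y))"
    proof (rule sum.cong[OF refl])
      fix y assume y: "y \<in> carrier K"
      then have "intertwiner f y * cnj (intertwiner f' y)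
          = f (H #> y) * cnj (f' (H #> y)) * (phase y * cnj (phase y))"
        by (simp add: intertwiner_def)
      then show "intertwiner f y * cnj (intertwiner f' y) = (\<lambda>c. f c * cnj (f' c)) (H #> y)"
        using y by (simp add: phase_cnj)
    qed
    moreover have "card H \<noteq> 0"
      using H finite_K subgroup.finite_imp_card_positive by fastforce
    ultimately show ?thesis
      using sum_coset[of "\<lambda>c. f c * cnj (f' c)"] by (simp add: induced_space_def l2_def)
  qed
  then show ?thesis
    using intertwiner_bij by (auto simp: unitary_iso_def intertwiner_def fun_eq_iff algebra_simps)
qed

lemma induced_rep_closed:
  "\<lbrakk>y \<in> carrier K; f \<in> vecs \<I>\<rbrakk> \<Longrightarrow> induced_rep K y f \<in> vecs \<I>"
  by (auto simp: induced_space_def induced_rep_def m_assoc[symmetric])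

lemma induced_rep_inv:
  "\<lbrakk>y \<in> carrier K; f \<in> vecs \<I>\<rbrakk> \<Longrightarrow> induced_rep K y (induced_rep K (inv y) f) = f"
  by (auto simp: induced_space_def induced_rep_def m_assoc[symmetric] fun_eq_iff)

lemma induced_rep_unitary:
  assumes y: "y \<in> carrier K"
  shows "unitary_iso \<I> \<I> (induced_rep K y)"
proof -
  have "bij_betw (induced_rep K y) (vecs \<I>) (vecs \<I>)"
    using y induced_rep_closed induced_rep_inv[of y] induced_rep_inv[of "inv y"]
    by (intro bij_betw_byWitness[where f' = "induced_rep K (inv y)"]) auto
  moreover have "(\<Sum>w\<in>carrier K. induced_rep K y f w * cnj (induced_rep K y f' w))
      = (\<Sum>w\<in>carrier K. f w * cnj (f' w))" for f f'
    by (rule sum.reindex_bij_witness[where i = "\<lambda>w. y \<otimes> w" and j = "\<lambda>w. inv y \<otimes> w"])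
      (use y in \<open>auto simp: induced_rep_def m_assoc[symmetric]\<close>)
  then have "cinner \<I> (induced_rep K y f) (induced_rep K y f') = cinner \<I> f f'" for f f'
    by (simp add: induced_space_def)
  ultimately show ?thesis
    by (auto simp: unitary_iso_def induced_rep_def)
qed

definition transported_rep :: "'q \<Rightarrow> ('q set \<Rightarrow> complex) \<Rightarrow> 'q set \<Rightarrow> complex" where
  "transported_rep y v = inv_into (vecs \<H>) intertwiner (induced_rep K y (intertwiner v))"

lemma transported_rep_unitary:
  assumes "y \<in> carrier K"
  shows "unitary_iso \<H> \<H> (transported_rep y)"
proof -
  have "unitary_iso \<I> \<H> (inv_into (vecs \<H>) intertwiner)"
    by (rule unitary_iso_inv[OF intertwiner_unitary]) (auto simp: l2_def)
  then show ?thesis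
    unfolding transported_rep_def
    by (intro unitary_iso_comp[OF unitary_iso_comp[OF intertwiner_unitary induced_rep_unitary[OF assms]]])
qed

lemma intertwiner_transported_rep:
  assumes "y \<in> carrier K" "v \<in> vecs \<I>"
  shows "intertwiner (transported_rep y (inv_into (vecs \<H>) intertwiner v)) = induced_rep K y v"
  using assms induced_rep_closed[OF assms] bij_betw_imp_surj_on[OF intertwiner_bij]
  by (simp add: transported_rep_def f_inv_into_f)

lemma transported_rep_basis_vec:
  assumes y: "y \<in> carrier K" and c: "c \<in> carrier (K Mod H)" and d: "d \<in> carrier (K Mod H)"
    and w: "w \<in> H" and eq: "y \<otimes> s c = w \<otimes> s d"
  shows "transported_rep y (basis_vec c) = (\<lambda>b. \<psi> w * basis_vec d b)"
  unfolding transported_rep_def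
proof (rule inv_into_f_eq)
  show "inj_on intertwiner (vecs \<H>)"
    using intertwiner_bij by (simp add: bij_betw_def)
  show "(\<lambda>b. \<psi> w * basis_vec d b) \<in> vecs \<H>"
    using d by (auto simp: l2_def basis_vec_def)
  show "intertwiner (\<lambda>b. \<psi> w * basis_vec d b) = induced_rep K y (intertwiner (basis_vec c))"
  proof
    fix u
    show "intertwiner (\<lambda>b. \<psi> w * basis_vec d b) u = induced_rep K y (intertwiner (basis_vec c)) u"
    proof (cases "u \<in> carrier K")
      case u: True
      have dyc: "d = (H #> y) \<otimes>\<^bsub>K Mod H\<^esub> c"
        using y c d w eq by (metis coset_mult coset_s s_closed coset_absorb)
      have "H #> (inv y \<otimes> u) = c \<longleftrightarrow> (H #> y) \<otimes>\<^bsub>K Mod H\<^esub> (H #> (inv y \<otimes> u)) = d"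
        unfolding dyc using y c u by (metis Q.l_cancel coset_closed m_closed inv_closed)
      then have iff: "H #> (inv y \<otimes> u) = c \<longleftrightarrow> H #> u = d"
        using y u by (simp add: coset_mult m_assoc[symmetric] del: mult_FactGroup)
      have "phase (inv y \<otimes> u) = \<psi> w * phase u" if "H #> u = d"
      proof -
        have "H #> (inv y \<otimes> u) = c"
          using iff that by simp
        then obtain h where h: "h \<in> H" "inv y \<otimes> u = h \<otimes> s c"
          using y u coset_factor by (metis m_closed inv_closed)
        have "u = y \<otimes> (h \<otimes> s c)"
          using y u by (simp flip: h(2) add: m_assoc[symmetric])
        also have "\<dots> = h \<otimes> (y \<otimes> s c)"
          using y c h(1) central[OF h(1) y] by (simp add: m_assoc[symmetric])
        also have "\<dots> = (h \<otimes> w) \<otimes> s d"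
          using eq h(1) w d by (simp add: m_assoc)
        finally have "phase u = inverse (\<psi> h) * inverse (\<psi> w)"
          using h(1) w d by (simp add: phase_eq \<psi>_mult)
        then show ?thesis
          using h w c by (simp add: phase_eq)
      qed
      then show ?thesis
        using u y iff by (simp add: intertwiner_def induced_rep_def basis_vec_def)
    qed (simp add: intertwiner_def induced_rep_def)
  qed
qed

end

lemma mod_integer_hom:
  assumes "group K" "z \<in> carrier K" and n: "n = group.ord K z" "n > 0"
  shows "(\<lambda>k. z [^]\<^bsub>K\<^esub> (k::int)) \<in> hom (integer_mod_group n) K"
    and "inj_on (\<lambda>k. z [^]\<^bsub>K\<^esub> (k::int)) (carrier (integer_mod_group n))"
    and "z [^]\<^bsub>K\<^esub> (k mod int n) = z [^]\<^bsub>K\<^esub> k"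
proof -
  interpret group K by fact
  have mod: "z [^]\<^bsub>K\<^esub> (k mod int n) = z [^]\<^bsub>K\<^esub> k" for k
    using assms(2) by (simp add: int_pow_eq mod_eq_dvd_iff[symmetric] n(1)[symmetric])
  then show "z [^]\<^bsub>K\<^esub> (k mod int n) = z [^]\<^bsub>K\<^esub> k" .
  show "(\<lambda>k. z [^]\<^bsub>K\<^esub> (k::int)) \<in> hom (integer_mod_group n) K"
    using assms(2) n(2) by (auto simp: hom_def mod mult_integer_mod_group int_pow_mult)
  show "inj_on (\<lambda>k. z [^]\<^bsub>K\<^esub> (k::int)) (carrier (integer_mod_group n))"
    using assms(2) n(2) by (auto simp: inj_on_def carrier_integer_mod_group int_pow_eq
        simp flip: n(1) mod_eq_dvd_iff)
qed

lemma (in integral_central_extension) central_quotient_rep: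
  fixes K :: "('q, 'n) monoid_scheme"
  assumes x: "corresponds_to_extension G E \<iota> \<phi> x"
    and sec: "is_section G E \<phi> \<theta>" and \<sigma>: "is_section_cocycle G E \<iota> \<theta> \<sigma>"
    and quot: "finite_quotient E K p"
    and n: "group.ord K (p (\<iota> 1)) = n"
    and \<psi>: "\<psi> \<in> hom (K\<lparr>carrier := H\<rparr>) circle_group"
    and \<psi>_gen: "\<psi> (p (\<iota> 1)) = exp (2 * complex_of_real pi * \<i> / of_nat n)"
    and H_def: "H = generate K {p (\<iota> 1)}"
    and q_def: "q = induced_quotient_map E \<phi> K p H"
  shows "\<exists>\<sigma>n \<alpha>n \<rho> W.
    \<sigma>n \<in> x \<and> n_Q_type G n (K Mod H) q \<sigma>n \<and>
    \<alpha>n \<in> carrier (C1 G integer_group) \<and>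
    \<sigma>n \<otimes>\<^bsub>C2 G integer_group\<^esub> cobd1 G integer_group \<alpha>n = \<sigma> \<and>
    (\<forall>g\<in>carrier G. unitary_iso (l2 (carrier (K Mod H))) (l2 (carrier (K Mod H))) (\<rho> g)) \<and>
    (\<forall>g\<^sub>1\<in>carrier G. \<forall>g\<^sub>2\<in>carrier G.
       \<rho> g\<^sub>1 (basis_vec (q g\<^sub>2)) =
       (\<lambda>c. exp (2 * complex_of_real pi * \<i> / of_nat n * of_int (\<alpha>n g\<^sub>1 + \<sigma>n (g\<^sub>1, g\<^sub>2)))
             * basis_vec (q g\<^sub>1 \<otimes>\<^bsub>K Mod H\<^esub> q g\<^sub>2) c)) \<and>
    unitary_iso (l2 (carrier (K Mod H))) (induced_space K H \<psi>) W \<and>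
    (\<forall>g\<in>carrier G. \<forall>v\<in>vecs (induced_space K H \<psi>).
       W (\<rho> g (inv_into (vecs (l2 (carrier (K Mod H)))) W v)) = induced_rep K (p (\<theta> g)) v)"
proof -
  define z where "z = p (\<iota> 1)"
  have fin: "finite (carrier K)" and "group K" and p_epi: "p \<in> epi E K"
    using quot by (auto simp: finite_quotient_def)
  interpret K: group K by fact
  have p_hom: "p \<in> hom E K" and p_surj: "p ` carrier E = carrier K"
    using p_epi by (auto simp: epi_def)
  interpret p: group_hom E K p
    by unfold_locales (rule p_hom)
  interpret \<iota>: group_hom integer_group E \<iota>
    using \<iota>_mon by (intro group_hom.intro group_hom_axioms.intro) (simp_all add: mon_def)
  have p_\<iota>: "p (\<iota> k) = z [^]\<^bsub>K\<^esub> k" for k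
    using \<iota>.hom_int_pow[of 1 k] p.hom_int_pow[of "\<iota> 1" k] by (simp add: z_def)
  have z_closed [simp]: "z \<in> carrier K"
    by (simp add: z_def)
  have H_eq: "H = range (\<lambda>k. p (\<iota> k))"
    using K.generate_pow[of z] by (simp add: H_def p_\<iota> full_SetCompr_eq z_def [symmetric])
  then have p_\<iota>_H: "p (\<iota> k) \<in> H" for k
    by simp
  have H: "subgroup H K"
    unfolding H_def by (rule K.generate_is_subgroup) simp
  have central: "y \<otimes>\<^bsub>K\<^esub> h = h \<otimes>\<^bsub>K\<^esub> y" if h: "h \<in> H" and y: "y \<in> carrier K" for h y
  proof -
    obtain k e where "h = p (\<iota> k)" "y = p e" "e \<in> carrier E"
      using h y H_eq p_surj by blast
    then show ?thesis
      using \<iota>_central[of e k] by (simp flip: p.hom_mult)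
  qed
  have "\<forall>c\<in>carrier (K Mod H). \<exists>y. y \<in> c"
    using K.rcos_self[OF _ H] by (auto simp: FactGroup_def RCOSETS_def)
  then obtain s where s: "\<And>c. c \<in> carrier (K Mod H) \<Longrightarrow> s c \<in> c"
    by metis
  interpret central_character K H \<psi> s
    by (intro central_character.intro central_character_axioms.intro) (fact K.is_group fin H central \<psi> s)+
  have n_pos: "n > 0"
    using K.ord_ge_1[OF fin, of z] n by (simp add: z_def)
  note pow_z = mod_integer_hom[OF K.is_group z_closed n[folded z_def, symmetric] n_pos]
  have q_\<phi>: "q (\<phi> e) = H #>\<^bsub>K\<^esub> p e" if "e \<in> carrier E" for e
    unfolding q_def using H_eq that
    by (intro induced_quotient_map_eq[OF K.is_group p_hom H]) auto
  have q_closed [simp]: "q g \<in> carrier (K Mod H)" if "g \<in> carrier G" for g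
    using \<phi>_surj[OF that] q_\<phi> by auto
  have q_mult: "q g \<otimes>\<^bsub>K Mod H\<^esub> q h = q (g \<otimes>\<^bsub>G\<^esub> h)" if gh: "g \<in> carrier G" "h \<in> carrier G" for g h
  proof -
    obtain e f where "e \<in> carrier E" "f \<in> carrier E" "g = \<phi> e" "h = \<phi> f"
      using \<phi>_surj gh by metis
    then show ?thesis
      by (simp add: q_\<phi> coset_mult flip: \<phi>_mult del: mult_FactGroup)
  qed
  have "\<exists>e\<in>carrier E. \<phi> e = g \<and> p e = s (q g)" if g: "g \<in> carrier G" for g
  proof -
    obtain f where f: "f \<in> carrier E" "\<phi> f = g"
      using \<phi>_surj[OF g] by blast
    then have "H #>\<^bsub>K\<^esub> s (q g) = H #>\<^bsub>K\<^esub> p f"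
      using q_\<phi>[OF f(1)] g by simp
    then obtain h where "h \<in> H" "s (q g) = h \<otimes>\<^bsub>K\<^esub> p f"
      using f g by (elim coset_eqD[rotated 2]) auto
    then obtain k where "s (q g) = p (\<iota> k) \<otimes>\<^bsub>K\<^esub> p f"
      using H_eq by blast
    then show ?thesis
      using f g by (intro bexI[of _ "\<iota> k \<otimes>\<^bsub>E\<^esub> f"]) auto
  qed
  then obtain \<theta>n where \<theta>n: "\<And>g. g \<in> carrier G \<Longrightarrow> \<theta>n g \<in> carrier E"
      "\<And>g. g \<in> carrier G \<Longrightarrow> \<phi> (\<theta>n g) = g" "\<And>g. g \<in> carrier G \<Longrightarrow> p (\<theta>n g) = s (q g)"
    by metis
  then have sec': "is_section G E \<phi> \<theta>n"
    by (simp add: is_section_def)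
  obtain \<sigma>n where \<sigma>n: "is_section_cocycle G E \<iota> \<theta>n \<sigma>n"
    using ex_section_cocycle[OF sec'] .
  obtain \<alpha>n where \<alpha>n: "\<alpha>n \<in> carrier (C1 G integer_group)"
    and \<theta>_eq: "\<And>g. g \<in> carrier G \<Longrightarrow> \<theta> g = \<iota> (\<alpha>n g) \<otimes>\<^bsub>E\<^esub> \<theta>n g"
    using sections_differ[OF sec sec'] by blast
  have p_mult: "s (q g) \<otimes>\<^bsub>K\<^esub> s (q h) = p (\<iota> (\<sigma>n (g, h))) \<otimes>\<^bsub>K\<^esub> s (q (g \<otimes>\<^bsub>G\<^esub> h))"
    if "g \<in> carrier G" "h \<in> carrier G" for g h
  proof -
    have "p (\<theta>n g \<otimes>\<^bsub>E\<^esub> \<theta>n h) = p (\<iota> (\<sigma>n (g, h)) \<otimes>\<^bsub>E\<^esub> \<theta>n (g \<otimes>\<^bsub>G\<^esub> h))"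
      using \<sigma>n that by (simp add: section_cocycle_iff[OF sec'])
    then show ?thesis
      using that \<theta>n by simp
  qed
  have "\<exists>t\<in>carrier (integer_mod_group n). s a \<otimes>\<^bsub>K\<^esub> s b = z [^]\<^bsub>K\<^esub> t \<otimes>\<^bsub>K\<^esub> s (a \<otimes>\<^bsub>K Mod H\<^esub> b)"
    if ab: "a \<in> carrier (K Mod H)" "b \<in> carrier (K Mod H)" for a b
  proof -
    have "H #>\<^bsub>K\<^esub> (s a \<otimes>\<^bsub>K\<^esub> s b) = a \<otimes>\<^bsub>K Mod H\<^esub> b"
      using coset_mult[of "s a" "s b"] ab by (simp del: mult_FactGroup)
    also have "\<dots> = H #>\<^bsub>K\<^esub> s (a \<otimes>\<^bsub>K Mod H\<^esub> b)"
      using ab Q.m_closed coset_s by presburger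
    finally obtain h where "h \<in> H" and h: "s a \<otimes>\<^bsub>K\<^esub> s b = h \<otimes>\<^bsub>K\<^esub> s (a \<otimes>\<^bsub>K Mod H\<^esub> b)"
      using ab Q.m_closed s_closed K.m_closed by (metis coset_eqD)
    from this(1) obtain k :: int where "h = z [^]\<^bsub>K\<^esub> k"
      unfolding H_eq p_\<iota> by blast
    with h show ?thesis
      using n_pos by (intro bexI[of _ "k mod int n"]) (auto simp: pow_z(3) carrier_integer_mod_group)
  qed
  then obtain t where t: "\<And>a b. \<lbrakk>a \<in> carrier (K Mod H); b \<in> carrier (K Mod H)\<rbrakk>
      \<Longrightarrow> t a b \<in> carrier (integer_mod_group n) \<and>
          s a \<otimes>\<^bsub>K\<^esub> s b = z [^]\<^bsub>K\<^esub> t a b \<otimes>\<^bsub>K\<^esub> s (a \<otimes>\<^bsub>K Mod H\<^esub> b)"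
    by metis
  define \<tau> where "\<tau> = restrict (case_prod t) (carrier (K Mod H) \<times> carrier (K Mod H))"
  have "\<tau> \<in> cocycles2 (K Mod H) (integer_mod_group n)"
  proof (rule section_cocycle_in_cocycles2[OF Q.is_group K.is_group _ pow_z(1,2)])
    show "comm_group (integer_mod_group n)"
      by simp
    show "z [^]\<^bsub>K\<^esub> k \<otimes>\<^bsub>K\<^esub> y = y \<otimes>\<^bsub>K\<^esub> z [^]\<^bsub>K\<^esub> k" if "y \<in> carrier K" for k :: int and y
      using central[OF _ that, of "z [^]\<^bsub>K\<^esub> k"] H_eq p_\<iota> by auto
    show "\<tau> \<in> carrier (C2 (K Mod H) (integer_mod_group n))"
      using t by (auto simp: \<tau>_def C2_def)
    show "s a \<otimes>\<^bsub>K\<^esub> s b = z [^]\<^bsub>K\<^esub> \<tau> (a, b) \<otimes>\<^bsub>K\<^esub> s (a \<otimes>\<^bsub>K Mod H\<^esub> b)"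
      if "a \<in> carrier (K Mod H)" "b \<in> carrier (K Mod H)" for a b
      using t[OF that] that by (simp add: \<tau>_def del: mult_FactGroup)
  qed simp
  moreover have "\<sigma>n (g, h) mod int n = \<tau> (q g, q h)" if gh: "g \<in> carrier G" "h \<in> carrier G" for g h
  proof -
    have "z [^]\<^bsub>K\<^esub> \<sigma>n (g, h) \<otimes>\<^bsub>K\<^esub> s (q (g \<otimes>\<^bsub>G\<^esub> h)) = z [^]\<^bsub>K\<^esub> t (q g) (q h) \<otimes>\<^bsub>K\<^esub> s (q (g \<otimes>\<^bsub>G\<^esub> h))"
      using t[of "q g" "q h"] gh p_mult[OF gh] by (simp add: p_\<iota> q_mult del: mult_FactGroup)
    then have "z [^]\<^bsub>K\<^esub> (\<sigma>n (g, h) mod int n) = z [^]\<^bsub>K\<^esub> t (q g) (q h)"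
      using gh by (simp add: pow_z(3))
    then have "\<sigma>n (g, h) mod int n = t (q g) (q h)"
      using t[of "q g" "q h"] gh n_pos
      by (intro inj_onD[OF pow_z(2)]) (auto simp: carrier_integer_mod_group)
    then show ?thesis
      using gh by (simp add: \<tau>_def)
  qed
  ultimately have type: "n_Q_type G n (K Mod H) q \<sigma>n"
    using section_cocycle_cocycle[OF sec' \<sigma>n] by (auto simp: n_Q_type_def)

  let ?\<zeta> = "2 * complex_of_real pi * \<i> / of_nat n"
  have \<psi>_pow: "\<psi> (p (\<iota> k)) = exp (?\<zeta> * of_int k)" for k
  proof (induction k rule: int_induct[where k = 0])
    case base
    show ?case using \<psi>_one p_\<iota>[of 0] by simp
  next
    case (step1 k)
    then show ?case
      using \<psi>_mult[of "p (\<iota> k)" "p (\<iota> 1)"] H_eq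
      by (simp add: \<iota>_add \<psi>_gen ring_distribs exp_add)
  next
    case (step2 k)
    have "\<psi> (p (\<iota> (k - 1))) * exp ?\<zeta> = \<psi> (p (\<iota> k))"
      using \<psi>_mult[of "p (\<iota> (k - 1))" "p (\<iota> 1)"] H_eq \<iota>_add[of "k - 1" 1] by (simp add: \<psi>_gen)
    also have "\<dots> = exp (?\<zeta> * of_int (k - 1)) * exp ?\<zeta>"
      unfolding step2.IH exp_add [symmetric] by (simp add: right_diff_distrib)
    finally show ?case
      by simp
  qed
  have basis: "transported_rep (p (\<theta> g)) (basis_vec (q h))
      = (\<lambda>c. exp (?\<zeta> * of_int (\<alpha>n g + \<sigma>n (g, h))) * basis_vec (q g \<otimes>\<^bsub>K Mod H\<^esub> q h) c)"
    if gh: "g \<in> carrier G" "h \<in> carrier G" for g h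
  proof -
    have "p (\<theta> g) \<otimes>\<^bsub>K\<^esub> s (q h) = p (\<iota> (\<alpha>n g)) \<otimes>\<^bsub>K\<^esub> (s (q g) \<otimes>\<^bsub>K\<^esub> s (q h))"
      using gh \<theta>n by (simp add: \<theta>_eq K.m_assoc)
    also have "\<dots> = p (\<iota> (\<alpha>n g + \<sigma>n (g, h))) \<otimes>\<^bsub>K\<^esub> s (q g \<otimes>\<^bsub>K Mod H\<^esub> q h)"
      using gh by (simp add: p_mult \<iota>_add q_mult K.m_assoc del: mult_FactGroup)
    finally show ?thesis
      unfolding \<psi>_pow [symmetric]
      using gh section_closed[OF sec gh(1)] p_\<iota>_H
      by (intro transported_rep_basis_vec) (auto simp: q_mult simp del: mult_FactGroup)
  qed
  show ?thesis
  proof (intro exI conjI ballI)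
    show "\<sigma>n \<in> x"
      by (rule section_cocycle_in_class[OF x sec' \<sigma>n])
    show "\<sigma>n \<otimes>\<^bsub>C2 G integer_group\<^esub> cobd1 G integer_group \<alpha>n = \<sigma>"
      using \<theta>_eq by (rule section_cocycles_cohomologous[OF sec sec' \<sigma> \<sigma>n])
    show "unitary_iso \<H> \<I> intertwiner"
      by (rule intertwiner_unitary)
    show "unitary_iso \<H> \<H> (transported_rep (p (\<theta> g)))" if "g \<in> carrier G" for g
      using section_closed[OF sec that] by (intro transported_rep_unitary) simp
    show "intertwiner (transported_rep (p (\<theta> g)) (inv_into (vecs \<H>) intertwiner v)) = induced_rep K (p (\<theta> g)) v"
      if "g \<in> carrier G" "v \<in> vecs \<I>" for g v
      using section_closed[OF sec that(1)] that(2) by (intro intertwiner_transported_rep) simp_all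
  qed (fact type \<alpha>n basis)+
qed

theorem theorem6p1:
  fixes G :: "'g monoid" and E :: "'e monoid"
    and \<iota> :: "int \<Rightarrow> 'e" and \<phi> :: "'e \<Rightarrow> 'g"
    and x :: "('g \<times> 'g \<Rightarrow> int) set"
    and \<Gamma> :: "nat \<Rightarrow> 'e set"
    and S :: "nat set"
    and \<theta> :: "'g \<Rightarrow> 'e" and \<sigma> :: "'g \<times> 'g \<Rightarrow> int"
    and Qt :: "nat \<Rightarrow> 'q monoid" and qt :: "nat \<Rightarrow> 'e \<Rightarrow> 'q"
    and \<psi> :: "nat \<Rightarrow> 'q \<Rightarrow> complex"
  assumes "group G" and "countable (carrier G)"
    and "x \<in> carrier (cohomology2 G integer_group)"
    and "central_extension G E \<iota> \<phi>"
    and "corresponds_to_extension G E \<iota> \<phi> x"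
    and "x \<notin> kernel (cohomology2 G integer_group) (hom_group (homology2 G) integer_group) (kronecker G)"
    and "\<And>k. subgroup (\<Gamma> k) E" and "\<And>k. finite (rcosets\<^bsub>E\<^esub> \<Gamma> k)"
    and "range \<iota> \<inter> (\<Inter>k. \<Gamma> k) = {\<one>\<^bsub>E\<^esub>}"
    and "S = finite_quotient_orders E (\<iota> 1)"
    and "is_section G E \<phi> \<theta>" and "is_section_cocycle G E \<iota> \<theta> \<sigma>"
    and "\<And>n. n \<in> S \<Longrightarrow> finite_quotient E (Qt n) (qt n)"
    and "\<And>n. n \<in> S \<Longrightarrow> group.ord (Qt n) (qt n (\<iota> 1)) = n"
    and "\<And>n. n \<in> S \<Longrightarrow> \<psi> n \<in> hom ((Qt n)\<lparr>carrier := generate (Qt n) {qt n (\<iota> 1)}\<rparr>) circle_group"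
    and "\<And>n. n \<in> S \<Longrightarrow> \<psi> n (qt n (\<iota> 1)) = exp (2 * complex_of_real pi * \<i> / of_nat n)"
  shows "\<forall>n\<in>S.
    (let H = generate (Qt n) {qt n (\<iota> 1)};
         Q = Qt n Mod H;
         q = induced_quotient_map E \<phi> (Qt n) (qt n) H;
         V = induced_space (Qt n) H (\<psi> n);
         \<pi> = induced_rep (Qt n)
     in \<exists>\<sigma>n \<alpha>n \<rho> W.
          \<sigma>n \<in> x \<and> n_Q_type G n Q q \<sigma>n \<and>
          \<alpha>n \<in> carrier (C1 G integer_group) \<and>
          \<sigma>n \<otimes>\<^bsub>C2 G integer_group\<^esub> cobd1 G integer_group \<alpha>n = \<sigma> \<and>
          (\<forall>g\<in>carrier G. unitary_iso (l2 (carrier Q)) (l2 (carrier Q)) (\<rho> g)) \<and>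
          (\<forall>g\<^sub>1\<in>carrier G. \<forall>g\<^sub>2\<in>carrier G.
             \<rho> g\<^sub>1 (basis_vec (q g\<^sub>2)) =
             (\<lambda>c. exp (2 * complex_of_real pi * \<i> / of_nat n * of_int (\<alpha>n g\<^sub>1 + \<sigma>n (g\<^sub>1, g\<^sub>2)))
                   * basis_vec (q g\<^sub>1 \<otimes>\<^bsub>Q\<^esub> q g\<^sub>2) c)) \<and>
          unitary_iso (l2 (carrier Q)) V W \<and>
          (\<forall>g\<in>carrier G. \<forall>v\<in>vecs V.
             W (\<rho> g (inv_into (vecs (l2 (carrier Q))) W v)) = \<pi> (qt n (\<theta> g)) v))"
proof -
  interpret integral_central_extension G E \<iota> \<phi>
    by unfold_locales (rule assms(4))
  show ?thesis
    unfolding Let_def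
    by (intro ballI, rule central_quotient_rep[OF assms(5,11,12) assms(13-16) refl refl])
qed

end
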